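(* There is no algorithm which, given a finite class table (obeying Java's prohibition of multiple instantiation inheritance) and two ground types $t$ and $t'$, decides whether $t \le t'$ holds according to that class table. That is, subtype checking is undecidable.
   Context: This is a formalization of a fragment of Java's type system (generic classes whose type parameters are used contravariantly, as with Java's "? super" wildcards). There is a set of classes, each with an arity $\ge 0$, and a set of type variables. Types are defined inductively: every type variable $x$ is a type; if $C$ is a class of arity $m \ge 0$ and $t_1,\dots,t_m$ are types, then $C t_1 \dots t_m$ is a type. A type is ground if it contains no type variables. A substitution $\sigma$ maps finitely many type variables to types; $t\sigma$ denotes the result of applying it. A class table is a finite set of inheritance rules of the form $C x_1 \dots x_m \lhd D t_1 \dots t_n$, where $m$ is the arity of $C$, $n$ is the arity of $D$, $x_1,\dots,x_m$ are type variables, and every type variable occurring in $t_1,\dots,t_n$ is among $x_1,\dots,x_m$. A class table defines a binary relation $\lhd$ on types: if $t_L \lhd t_R$ is an inheritance rule then $t_L\sigma \lhd t_R\sigma$ for every substitution $\sigma$. Let $\lhd^*$ be its reflexive transitive closure. The class table has no multiple instantiation inheritance (a restriction Java imposes) if whenever $t \lhd^* C t_1\dots t_m$ and $t \lhd^* C t'_1 \dots t'_m$ we have $t_i = t'_i$ for all $i$. The subtyping relation $\le$ is the relation defined inductively by the single rule: if $A t_1\dots t_m \lhd^* C t'_1 \dots t'_n$ and $t''_i \le t'_i$ for all $1\le i\le n$, then $A t_1 \dots t_m \le C t''_1 \dots t''_n$ (so type arguments are contravariant). *)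

theory Defs
  imports Main "HOL-Library.Nat_Bijection"
begin

text \<open>Classes and type variables are named by natural numbers.\<close>
datatype ty = TVar nat | TApp nat "ty list"

text \<open>An inheritance rule  C x1 .. xm  <|  D t1 .. tn  is stored as (C, [x1..xm], D, [t1..tn]).\<close>
type_synonym rule = "nat \<times> nat list \<times> nat \<times> ty list"
type_synonym class_table = "rule list"
type_synonym arity_map = "(nat \<times> nat) list"

fun tvars :: "ty \<Rightarrow> nat set" where
  "tvars (TVar x) = {x}"
| "tvars (TApp c ts) = (\<Union>t\<in>set ts. tvars t)"

definition ground :: "ty \<Rightarrow> bool" where
  "ground t \<longleftrightarrow> tvars t = {}"

fun subst :: "(nat \<Rightarrow> ty) \<Rightarrow> ty \<Rightarrow> ty" where
  "subst \<sigma> (TVar x) = \<sigma> x"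
| "subst \<sigma> (TApp c ts) = TApp c (map (subst \<sigma>) ts)"

fun wf_ty :: "arity_map \<Rightarrow> ty \<Rightarrow> bool" where
  "wf_ty ar (TVar x) = True"
| "wf_ty ar (TApp c ts) = (map_of ar c = Some (length ts) \<and> (\<forall>t\<in>set ts. wf_ty ar t))"

fun wf_rule :: "arity_map \<Rightarrow> rule \<Rightarrow> bool" where
  "wf_rule ar (C, xs, D, ts) =
     (map_of ar C = Some (length xs) \<and> distinct xs \<and>
      map_of ar D = Some (length ts) \<and> (\<forall>t\<in>set ts. wf_ty ar t) \<and>
      (\<Union>t\<in>set ts. tvars t) \<subseteq> set xs)"

definition wf_table :: "arity_map \<Rightarrow> class_table \<Rightarrow> bool" where
  "wf_table ar ct \<longleftrightarrow> (\<forall>r\<in>set ct. wf_rule ar r)"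

definition inh :: "class_table \<Rightarrow> ty \<Rightarrow> ty \<Rightarrow> bool" where
  "inh ct s t \<longleftrightarrow> (\<exists>C xs D ts \<sigma>. (C, xs, D, ts) \<in> set ct \<and>
       s = subst \<sigma> (TApp C (map TVar xs)) \<and> t = subst \<sigma> (TApp D ts))"

abbreviation inh_star :: "class_table \<Rightarrow> ty \<Rightarrow> ty \<Rightarrow> bool" where
  "inh_star ct \<equiv> (inh ct)\<^sup>*\<^sup>*"

definition no_mii :: "arity_map \<Rightarrow> class_table \<Rightarrow> bool" where
  "no_mii ar ct \<longleftrightarrow> (\<forall>t C us us'. wf_ty ar t \<longrightarrow>
       inh_star ct t (TApp C us) \<longrightarrow> inh_star ct t (TApp C us') \<longrightarrow> us = us')"

inductive subtype :: "class_table \<Rightarrow> ty \<Rightarrow> ty \<Rightarrow> bool" where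
  sub: "inh_star ct (TApp A ts) (TApp C ts') \<Longrightarrow> length us = length ts' \<Longrightarrow>
        (\<forall>i<length ts'. subtype ct (us ! i) (ts' ! i)) \<Longrightarrow>
        subtype ct (TApp A ts) (TApp C us)"

definition valid_instance :: "arity_map \<Rightarrow> class_table \<Rightarrow> ty \<Rightarrow> ty \<Rightarrow> bool" where
  "valid_instance ar ct t t' \<longleftrightarrow> wf_table ar ct \<and> no_mii ar ct \<and>
     wf_ty ar t \<and> wf_ty ar t' \<and> ground t \<and> ground t'"

fun enc_ty :: "ty \<Rightarrow> nat" where
  "enc_ty (TVar x) = prod_encode (0, x)"
| "enc_ty (TApp c ts) = prod_encode (1, prod_encode (c, list_encode (map enc_ty ts)))"

fun enc_rule :: "rule \<Rightarrow> nat" where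
  "enc_rule (C, xs, D, ts) =
     prod_encode (C, prod_encode (list_encode xs, prod_encode (D, list_encode (map enc_ty ts))))"

definition enc_instance :: "arity_map \<Rightarrow> class_table \<Rightarrow> ty \<Rightarrow> ty \<Rightarrow> nat" where
  "enc_instance ar ct t t' =
     prod_encode (list_encode (map prod_encode ar),
       prod_encode (list_encode (map enc_rule ct), prod_encode (enc_ty t, enc_ty t')))"

datatype recf = Zr | Sc | Proj nat | Cn recf "recf list" | Pr recf recf | Mn recf

inductive eval :: "recf \<Rightarrow> nat list \<Rightarrow> nat \<Rightarrow> bool" where
  ev_Z: "eval Zr xs 0"
| ev_S: "eval Sc (x # xs) (Suc x)"
| ev_Id: "i < length xs \<Longrightarrow> eval (Proj i) xs (xs ! i)"
| ev_Cn: "length ys = length gs \<Longrightarrow> (\<forall>i<length gs. eval (gs ! i) xs (ys ! i)) \<Longrightarrow>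
          eval f ys r \<Longrightarrow> eval (Cn f gs) xs r"
| ev_Pr0: "eval f xs r \<Longrightarrow> eval (Pr f g) (0 # xs) r"
| ev_PrS: "eval (Pr f g) (y # xs) r' \<Longrightarrow> eval g (y # r' # xs) r \<Longrightarrow>
          eval (Pr f g) (Suc y # xs) r"
| ev_Mn: "eval f (y # xs) 0 \<Longrightarrow> (\<forall>z<y. \<exists>v. v > 0 \<and> eval f (z # xs) v) \<Longrightarrow>
          eval (Mn f) xs y"

end

theory Submission
  imports Defs
begin

text \<open>A subtyping query between unary types is a pair of stacks that exchange roles at every step, so
  a class table can run a machine with two stacks. Keeping a multiset of register names on the
  stacks gives a counter machine, and every recursive function is computed by some counter machine.
  Suppose \<open>r\<close> decides subtyping. Take the machine that reads the codes \<open>a\<close> and \<open>b\<close> of an arity map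
  and a class table, applies \<open>r\<close> to the instance whose table is the one coded by \<open>b\<close> and whose query
  starts that table's machine on \<open>a, b\<close>, and accepts iff the answer is \<open>0\<close>. Fed with the codes of
  its own arity map and table, it accepts iff \<open>r\<close> says that it does not.\<close>

section \<open>Some recursive functions\<close>

inductive_cases eval_ZrE: "eval Zr xs y"
inductive_cases eval_ScE: "eval Sc xs y"
inductive_cases eval_ProjE: "eval (Proj i) xs y"
inductive_cases eval_CnE: "eval (Cn f gs) xs y"
inductive_cases eval_PrE: "eval (Pr f g) xs y"
inductive_cases eval_Pr0E: "eval (Pr f g) (0 # xs) y"
inductive_cases eval_PrSE: "eval (Pr f g) (Suc n # xs) y"
inductive_cases eval_MnE: "eval (Mn f) xs y"

lemma eval_Proj: "i < length xs \<Longrightarrow> xs ! i = y \<Longrightarrow> eval (Proj i) xs y"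
  using ev_Id by blast

lemma eval_Cn1: "eval g xs a \<Longrightarrow> eval f [a] y \<Longrightarrow> eval (Cn f [g]) xs y"
  by (rule ev_Cn[where ys = "[a]"]) auto

lemma eval_Cn2: "eval g xs a \<Longrightarrow> eval h xs b \<Longrightarrow> eval f [a, b] y \<Longrightarrow> eval (Cn f [g, h]) xs y"
  by (rule ev_Cn[where ys = "[a, b]"]) (auto simp: less_Suc_eq)

primrec rf_const :: "nat \<Rightarrow> recf" where
  "rf_const 0 = Zr"
| "rf_const (Suc n) = Cn Sc [rf_const n]"

lemma eval_const: "eval (rf_const n) xs n"
  by (induction n) (auto intro: ev_Z ev_S eval_Cn1)

definition rf_add :: recf where
  "rf_add = Pr (Proj 0) (Cn Sc [Proj 1])"

lemma eval_add: "eval rf_add [a, b] (a + b)"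
  unfolding rf_add_def
proof (induction a)
  case 0
  show ?case by (intro ev_Pr0 eval_Proj) auto
next
  case (Suc a)
  have "eval (Cn Sc [Proj 1]) [a, a + b, b] (Suc (a + b))"
    by (rule eval_Cn1[OF eval_Proj ev_S]) auto
  from ev_PrS[OF Suc this] show ?case by simp
qed

definition rf_triangle :: recf where
  "rf_triangle = Pr Zr (Cn rf_add [Proj 1, Cn Sc [Proj 0]])"

lemma eval_triangle: "eval rf_triangle [n] (triangle n)"
  unfolding rf_triangle_def
proof (induction n)
  case 0
  show ?case by (auto intro: ev_Pr0 ev_Z)
next
  case (Suc n)
  have "eval (Cn rf_add [Proj 1, Cn Sc [Proj 0]]) [n, triangle n] (triangle n + Suc n)"
    by (rule eval_Cn2[OF _ _ eval_add]) (auto intro!: eval_Cn1 eval_Proj ev_S)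
  from ev_PrS[OF Suc this] show ?case by simp
qed

text \<open>Cantor's pairing: \<open>prod_encode (a, b)\<close> is
  \<open>triangle (a + b) + a\<close>.\<close>

definition rf_pair :: "recf \<Rightarrow> recf \<Rightarrow> recf" where
  "rf_pair f g = Cn rf_add [Cn rf_triangle [Cn rf_add [f, g]], f]"

lemma eval_pair:
  "eval f xs a \<Longrightarrow> eval g xs b \<Longrightarrow> eval (rf_pair f g) xs (prod_encode (a, b))"
  unfolding rf_pair_def prod_encode_def
  by (auto intro!: eval_Cn2[OF _ _ eval_add] eval_Cn1[OF _ eval_triangle])

section \<open>Counter programs\<close>

text \<open>\<open>Loop i p\<close> decrements register \<open>i\<close> before each execution of \<open>p\<close> and stops when it is zero.\<close>

datatype prog = Inc nat | Clear nat | Seq prog prog | Loop nat prog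

inductive run :: "prog \<Rightarrow> (nat \<Rightarrow> nat) \<Rightarrow> (nat \<Rightarrow> nat) \<Rightarrow> bool" where
  run_Inc: "run (Inc i) s (s(i := Suc (s i)))"
| run_Clear: "run (Clear i) s (s(i := 0))"
| run_Seq: "run p s s' \<Longrightarrow> run q s' s'' \<Longrightarrow> run (Seq p q) s s''"
| run_Loop0: "s i = 0 \<Longrightarrow> run (Loop i p) s s"
| run_LoopS: "s i = Suc k \<Longrightarrow> run p (s(i := k)) s' \<Longrightarrow> run (Loop i p) s' s'' \<Longrightarrow>
              run (Loop i p) s s''"

lemma run_Inc': "s' = s(i := Suc (s i)) \<Longrightarrow> run (Inc i) s s'"
  by (simp add: run_Inc)

lemma run_Clear': "s' = s(i := 0) \<Longrightarrow> run (Clear i) s s'"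
  by (simp add: run_Clear)

lemma run_move:
  assumes "a \<noteq> d"
  shows "run (Loop a (Inc d)) s (s(a := 0, d := s d + s a))"
proof (induction "s a" arbitrary: s)
  case 0
  then have *: "s(a := 0, d := s d + s a) = s" by (auto simp: fun_eq_iff)
  show ?case unfolding * using 0 by (intro run_Loop0) simp
next
  case (Suc k)
  let ?s = "s(a := k, d := Suc (s d))"
  have "run (Loop a (Inc d)) ?s (?s(a := 0, d := ?s d + ?s a))"
    using Suc(1)[of ?s] assms by simp
  moreover have "?s(a := 0, d := ?s d + ?s a) = s(a := 0, d := s d + s a)"
    using assms Suc(2)[symmetric] by (auto simp: fun_eq_iff)
  ultimately show ?case
    using assms Suc(2) by (auto intro!: run_LoopS[of s a k] run_Inc')
qed

lemma run_move2:
  assumes "a \<noteq> d" "a \<noteq> b" "b \<noteq> d"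
  shows "run (Loop a (Seq (Inc d) (Inc b))) s (s(a := 0, d := s d + s a, b := s b + s a))"
proof (induction "s a" arbitrary: s)
  case 0
  then have *: "s(a := 0, d := s d + s a, b := s b + s a) = s" by (auto simp: fun_eq_iff)
  show ?case unfolding * using 0 by (intro run_Loop0) simp
next
  case (Suc k)
  let ?s = "s(a := k, d := Suc (s d), b := Suc (s b))"
  let ?t = "s(a := 0, d := s d + s a, b := s b + s a)"
  have "run (Loop a (Seq (Inc d) (Inc b))) ?s (?s(a := 0, d := ?s d + ?s a, b := ?s b + ?s a))"
    using Suc(1)[of ?s] assms by simp
  moreover have "?s(a := 0, d := ?s d + ?s a, b := ?s b + ?s a) = ?t"
    using assms Suc(2)[symmetric] by (auto simp: fun_eq_iff)
  ultimately have "run (Loop a (Seq (Inc d) (Inc b))) ?s ?t" by simp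
  moreover have "run (Seq (Inc d) (Inc b)) (s(a := k)) ?s"
    by (rule run_Seq[OF run_Inc run_Inc']) (use assms in \<open>auto simp: fun_eq_iff\<close>)
  ultimately show ?case
    using Suc(2) by (intro run_LoopS[of s a k]) auto
qed

text \<open>Register \<open>b\<close> takes a second copy while \<open>a\<close> is emptied, so that
  \<open>a\<close> can be restored from it.\<close>

definition copy :: "nat \<Rightarrow> nat \<Rightarrow> nat \<Rightarrow> prog" where
  "copy a d b = Seq (Loop a (Seq (Inc d) (Inc b))) (Loop b (Inc a))"

lemma run_copy:
  assumes "a \<noteq> d" "a \<noteq> b" "b \<noteq> d" "s b = 0" "s' = s(d := s d + s a)"
  shows "run (copy a d b) s s'"
proof -
  let ?s = "s(a := 0, d := s d + s a, b := s b + s a)"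
  have "run (Loop b (Inc a)) ?s (?s(b := 0, a := ?s a + ?s b))"
    using assms by (intro run_move) auto
  moreover have "?s(b := 0, a := ?s a + ?s b) = s'"
    using assms by (auto simp: fun_eq_iff)
  ultimately show ?thesis
    unfolding copy_def using assms run_move2[of a d b s] by (auto intro: run_Seq)
qed

text \<open>The base case is harmless: for positive \<open>k\<close> register \<open>b\<close> is
  cleared anyway, and for \<open>k = 0\<close> it is a scratch register that is already
  zero.\<close>

primrec clears :: "nat \<Rightarrow> nat \<Rightarrow> prog" where
  "clears b 0 = Clear b"
| "clears b (Suc k) = Seq (Clear (b + k)) (clears b k)"

lemma run_clears: "run (clears b k) s (\<lambda>j. if b \<le> j \<and> j < b + k \<or> j = b then 0 else s j)"
proof (induction k arbitrary: s)
  case 0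
  show ?case by (auto intro!: run_Clear')
next
  case (Suc k)
  let ?s = "s(b + k := 0)"
  have *: "(\<lambda>j. if b \<le> j \<and> j < b + k \<or> j = b then 0 else ?s j) =
        (\<lambda>j. if b \<le> j \<and> j < b + Suc k \<or> j = b then 0 else s j)"
    by (auto simp: fun_eq_iff)
  show ?case
    using run_Seq[OF run_Clear Suc[of ?s]] unfolding * clears.simps .
qed

text \<open>\<open>comp_recf f as d b\<close> computes \<open>f\<close> of the registers \<open>as\<close> into register \<open>d\<close>, which must be zero;
  registers from \<open>b\<close> on are scratch space, zero before and after. Hence \<open>Clear b\<close> can serve as
  a no-op.\<close>

fun comp_recf :: "recf \<Rightarrow> nat list \<Rightarrow> nat \<Rightarrow> nat \<Rightarrow> prog"
  and comp_list :: "recf list \<Rightarrow> nat list \<Rightarrow> nat \<Rightarrow> nat \<Rightarrow> prog" where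
  "comp_recf Zr as d b = Clear d"
| "comp_recf Sc as d b = Seq (copy (hd as) d b) (Inc d)"
| "comp_recf (Proj i) as d b = copy (as ! i) d b"
| "comp_recf (Cn f gs) as d b =
     Seq (comp_list gs as b (b + length gs))
    (Seq (comp_recf f [b..<b + length gs] d (b + length gs))
         (clears b (length gs)))"
| "comp_recf (Pr f g) as d b =
     Seq (comp_recf f (tl as) b (b + 4))
    (Seq (copy (hd as) (b + 1) (b + 3))
    (Seq (Loop (b + 1)
           (Seq (comp_recf g ((b + 2) # b # tl as) (b + 3) (b + 4))
           (Seq (Clear b)
           (Seq (Loop (b + 3) (Inc b))
                (Inc (b + 2))))))
    (Seq (Loop b (Inc d))
         (Clear (b + 2)))))"
| "comp_recf (Mn f) as d b =
     Seq (comp_recf f (d # as) b (b + 1))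
         (Loop b (Seq (Clear b) (Seq (Inc d) (comp_recf f (d # as) b (b + 1)))))"
| "comp_list [] as d b = Clear b"
| "comp_list (g # gs) as d b = Seq (comp_recf g as d b) (comp_list gs as (Suc d) b)"

text \<open>Only \<open>d\<close> changes, so inputs survive and scratch registers are zero again;
  this lets compiled programs be chained. The choice of registers is left free because subprograms
  run with other ones.\<close>

definition correct :: "recf \<Rightarrow> bool" where
  "correct f \<longleftrightarrow> (\<forall>xs y as d b s. eval f xs y \<longrightarrow> map s as = xs \<longrightarrow>
     (\<forall>a\<in>set as. a < b \<and> a \<noteq> d) \<longrightarrow> d < b \<longrightarrow> s d = 0 \<longrightarrow> (\<forall>j\<ge>b. s j = 0) \<longrightarrow>
     run (comp_recf f as d b) s (s(d := y)))"

lemma correctD: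
  assumes "correct f" "eval f xs y" "map s as = xs" "\<And>a. a \<in> set as \<Longrightarrow> a < b \<and> a \<noteq> d"
    "d < b" "s d = 0" "\<And>j. b \<le> j \<Longrightarrow> s j = 0" "s' = s(d := y)"
  shows "run (comp_recf f as d b) s s'"
  using assms unfolding correct_def by blast

text \<open>The arguments lie below \<open>d\<close>, so storing one result leaves them intact for
  the next function.\<close>

lemma run_comp_list:
  assumes "\<forall>g\<in>set gs. correct g" "length ys = length gs"
    "\<forall>i<length gs. eval (gs ! i) (map s as) (ys ! i)"
    "\<forall>a\<in>set as. a < d" "d + length gs \<le> b" "\<forall>j\<ge>d. s j = 0"
  shows "run (comp_list gs as d b) s
           (\<lambda>j. if d \<le> j \<and> j < d + length gs then ys ! (j - d) else s j)"
  using assms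
proof (induction gs arbitrary: ys d s)
  case Nil
  then show ?case by (auto intro!: run_Clear' simp: fun_eq_iff)
next
  case (Cons g gs)
  from Cons.prems(2) obtain y zs where ys: "ys = y # zs" "length zs = length gs"
    by (cases ys) auto
  let ?s = "s(d := y)"
  have m: "map ?s as = map s as" using Cons.prems(4) by auto
  have "eval g (map s as) y" using Cons.prems(3) ys by force
  then have 1: "run (comp_recf g as d b) s ?s"
    using Cons.prems by (intro correctD[of g "map s as" y]) auto
  have *: "\<forall>i<length gs. eval (gs ! i) (map ?s as) (zs ! i)"
    using Cons.prems(3) ys(1) unfolding m by force
  have 2: "run (comp_list gs as (Suc d) b) ?s
      (\<lambda>j. if Suc d \<le> j \<and> j < Suc d + length gs then zs ! (j - Suc d) else ?s j)"
    by (rule Cons.IH[OF _ ys(2) *]) (use Cons.prems in auto)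
  have "(\<lambda>j. if Suc d \<le> j \<and> j < Suc d + length gs then zs ! (j - Suc d) else ?s j) =
      (\<lambda>j. if d \<le> j \<and> j < d + length (g # gs) then ys ! (j - d) else s j)"
    using ys by (auto simp: fun_eq_iff nth_Cons' Suc_diff_Suc)
  with 1 2 show ?case by (auto intro: run_Seq)
qed

lemma correct_Cn:
  assumes f: "correct f" and gs: "\<forall>g\<in>set gs. correct g"
  shows "correct (Cn f gs)"
  unfolding correct_def
proof (intro allI impI)
  fix xs y as d b and s :: "nat \<Rightarrow> nat"
  assume ev: "eval (Cn f gs) xs y" and xs: "map s as = xs"
    and as: "\<forall>a\<in>set as. a < b \<and> a \<noteq> d" and d: "d < b" "s d = 0" and z: "\<forall>j\<ge>b. s j = 0"
  from ev obtain ys where ys: "length ys = length gs" "\<forall>i<length gs. eval (gs ! i) xs (ys ! i)"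
    and fy: "eval f ys y" by (auto elim: eval_CnE)
  let ?k = "length gs"
  let ?s = "\<lambda>j. if b \<le> j \<and> j < b + ?k then ys ! (j - b) else s j"
  have 1: "run (comp_list gs as b (b + ?k)) s ?s"
    using gs ys xs as z by (intro run_comp_list) auto
  have "map ?s [b..<b + ?k] = ys" using ys(1) by (auto intro!: nth_equalityI)
  then have 2: "run (comp_recf f [b..<b + ?k] d (b + ?k)) ?s (?s(d := y))"
    using d z by (intro correctD[OF f fy]) auto
  have "(\<lambda>j. if b \<le> j \<and> j < b + ?k \<or> j = b then 0 else (?s(d := y)) j) = s(d := y)"
    using d z by (auto simp: fun_eq_iff)
  then have 3: "run (clears b ?k) (?s(d := y)) (s(d := y))"
    using run_clears[of b ?k "?s(d := y)"] by simp
  show "run (comp_recf (Cn f gs) as d b) s (s(d := y))"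
    using 1 2 3 by (auto intro!: run_Seq)
qed

text \<open>Collects the intermediate values of the recursion in one function \<open>v\<close>, from
  which the loop invariant is built.\<close>

lemma eval_Pr_values:
  assumes "eval (Pr f g) (n # xs) y"
  shows "\<exists>v. eval f xs (v 0) \<and> (\<forall>k<n. eval g (k # v k # xs) (v (Suc k))) \<and> y = v n"
  using assms
proof (induction n arbitrary: y)
  case 0
  then have "eval f xs y" by (rule eval_Pr0E)
  then show ?case by (intro exI[of _ "\<lambda>_. y"]) auto
next
  case (Suc n)
  from Suc.prems obtain r where r: "eval (Pr f g) (n # xs) r" "eval g (n # r # xs) y"
    by (rule eval_PrSE)
  from Suc.IH[OF r(1)] obtain v where
    v: "eval f xs (v 0)" "\<forall>k<n. eval g (k # v k # xs) (v (Suc k))" "r = v n" by blast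
  show ?case using v r by (intro exI[of _ "v(Suc n := y)"]) (auto simp: less_Suc_eq)
qed

lemma correct_Pr:
  assumes f: "correct f" and g: "correct g"
  shows "correct (Pr f g)"
  unfolding correct_def
proof (intro allI impI)
  fix xs y as d b and s :: "nat \<Rightarrow> nat"
  assume ev: "eval (Pr f g) xs y" and xs: "map s as = xs"
    and as: "\<forall>a\<in>set as. a < b \<and> a \<noteq> d" and d: "d < b" "s d = 0" and z: "\<forall>j\<ge>b. s j = 0"
  from ev obtain n ns where ns: "xs = n # ns" by (auto elim: eval_PrE)
  with xs obtain a as' where as': "as = a # as'" "s a = n" "map s as' = ns" by auto
  from eval_Pr_values[OF ev[unfolded ns]] obtain v where
    v: "eval f ns (v 0)" "\<And>k. k < n \<Longrightarrow> eval g (k # v k # ns) (v (Suc k))" "y = v n" by blast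
  \<comment> \<open>The state after \<open>k\<close> rounds: \<open>b\<close> holds the current
    value, \<open>b + 1\<close> the rounds left, \<open>b + 2\<close> the round counter;
    \<open>b + 3\<close> is zero between rounds.\<close>
  define S where "S k = s(b := v k, b + 1 := n - k, b + 2 := k)" for k
  let ?body = "Seq (comp_recf g ((b + 2) # b # as') (b + 3) (b + 4))
     (Seq (Clear b) (Seq (Loop (b + 3) (Inc b)) (Inc (b + 2))))"
  have ab: "a < b" and asb: "\<And>x. x \<in> set as' \<Longrightarrow> x < b" using as as' by auto
  have 1: "run (comp_recf f as' b (b + 4)) s (s(b := v 0))"
    by (rule correctD[OF f v(1)]) (use z as' in \<open>auto dest!: asb\<close>)
  have 2: "run (copy a (b + 1) (b + 3)) (s(b := v 0)) (S 0)"
    using ab z as' by (intro run_copy) (auto simp: S_def fun_eq_iff)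
  have body: "run ?body ((S k)(b + 1 := n - Suc k)) (S (Suc k))" if k: "k < n" for k
  proof -
    let ?s = "(S k)(b + 1 := n - Suc k)"
    have m: "map ?s ((b + 2) # b # as') = k # v k # ns"
      using asb as' by (force simp: S_def)
    have A: "run (comp_recf g ((b + 2) # b # as') (b + 3) (b + 4)) ?s (?s(b + 3 := v (Suc k)))"
      by (rule correctD[OF g v(2)[OF k] m])
         (use z in \<open>auto simp: S_def dest!: asb\<close>)
    let ?t = "?s(b + 3 := v (Suc k), b := 0)"
    have B: "run (Loop (b + 3) (Inc b)) ?t (?t(b + 3 := 0, b := ?t b + ?t (b + 3)))"
      by (rule run_move) simp
    have C: "run (Inc (b + 2)) (?t(b + 3 := 0, b := ?t b + ?t (b + 3))) (S (Suc k))"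
      using z by (intro run_Inc') (auto simp: S_def fun_eq_iff)
    show ?thesis using A B C by (auto intro!: run_Seq run_Clear)
  qed
  have loop: "k \<le> n \<Longrightarrow> run (Loop (b + 1) ?body) (S k) (S n)" for k
  proof (induction rule: inc_induct)
    case base
    show ?case by (rule run_Loop0) (simp add: S_def)
  next
    case (step k)
    have "S k (b + 1) = Suc (n - Suc k)" using step by (simp add: S_def)
    with body[of k] step show ?case by (auto intro: run_LoopS)
  qed
  have 3: "run (Loop b (Inc d)) (S n) ((S n)(b := 0, d := S n d + S n b))"
    using d by (intro run_move) simp
  have 4: "run (Clear (b + 2)) ((S n)(b := 0, d := S n d + S n b)) (s(d := y))"
    using d z v(3) by (intro run_Clear') (auto simp: S_def fun_eq_iff)
  show "run (comp_recf (Pr f g) as d b) s (s(d := y))"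
    using 1 2 3 4 loop[of 0] by (auto intro!: run_Seq simp: as'(1) simp del: fun_upd_apply)
qed

lemma correct_Mn:
  assumes f: "correct f"
  shows "correct (Mn f)"
  unfolding correct_def
proof (intro allI impI)
  fix xs y as d b and s :: "nat \<Rightarrow> nat"
  assume ev: "eval (Mn f) xs y" and xs: "map s as = xs"
    and as: "\<forall>a\<in>set as. a < b \<and> a \<noteq> d" and d: "d < b" "s d = 0" and z: "\<forall>j\<ge>b. s j = 0"
  from ev have "eval f (y # xs) 0" "\<forall>k<y. \<exists>v. v > 0 \<and> eval f (k # xs) v"
    by (auto elim: eval_MnE)
  then have "\<forall>k. \<exists>v. k \<le> y \<longrightarrow> eval f (k # xs) v \<and> (v = 0 \<longleftrightarrow> k = y)"
    by (metis le_neq_implies_less neq0_conv)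
  then obtain v where v: "\<And>k. k \<le> y \<Longrightarrow> eval f (k # xs) (v k)"
      "\<And>k. k \<le> y \<Longrightarrow> v k = 0 \<longleftrightarrow> k = y" by metis
  \<comment> \<open>The state after testing candidate \<open>k\<close>, which is kept in the output
    register itself. The loop uses \<open>b\<close> as a truth value: its body first clears what is
    left of it, then tests the next candidate.\<close>
  define S where "S k = s(d := k, b := v k)" for k
  have test: "run (comp_recf f (d # as) b (b + 1)) (s(d := k)) (S k)" if "k \<le> y" for k
  proof (rule correctD[OF f v(1)[OF that]])
    show "map (s(d := k)) (d # as) = k # xs" using xs as by auto
  qed (use as d z in \<open>auto simp: S_def\<close>)
  let ?body = "Seq (Clear b) (Seq (Inc d) (comp_recf f (d # as) b (b + 1)))"
  have loop: "k \<le> y \<Longrightarrow> run (Loop b ?body) (S k) (S y)" for k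
  proof (induction rule: inc_induct)
    case base
    show ?case by (rule run_Loop0) (use v(2) in \<open>simp add: S_def\<close>)
  next
    case (step k)
    then obtain m where m: "S k b = Suc m"
      using v(2)[of k] by (auto simp: S_def gr0_conv_Suc)
    have "run (Inc d) ((S k)(b := m, b := 0)) (s(d := Suc k))"
      using d z by (intro run_Inc') (auto simp: S_def fun_eq_iff)
    then have "run ?body ((S k)(b := m)) (S (Suc k))"
      using test[of "Suc k"] step by (auto intro!: run_Seq run_Clear)
    with m step show ?case by (auto intro: run_LoopS)
  qed
  have "s(d := 0) = s" using d by auto
  then have "run (comp_recf (Mn f) as d b) s (S y)"
    using test[of 0] loop[of 0] by (auto intro!: run_Seq)
  moreover have "S y = s(d := y)" using v(2)[of y] d z by (auto simp: S_def fun_eq_iff)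
  ultimately show "run (comp_recf (Mn f) as d b) s (s(d := y))" by simp
qed

lemma comp_recf_correct: "correct f"
proof (induction f)
  case Zr
  show ?case by (auto simp: correct_def elim!: eval_ZrE intro!: run_Clear')
next
  case Sc
  show ?case unfolding correct_def
  proof (intro allI impI)
    fix xs y as d b and s :: "nat \<Rightarrow> nat"
    assume ev: "eval Sc xs y" and xs: "map s as = xs"
      and as: "\<forall>a\<in>set as. a < b \<and> a \<noteq> d" and d: "d < b" "s d = 0" and z: "\<forall>j\<ge>b. s j = 0"
    from ev obtain x zs where "xs = x # zs" "y = Suc x" by (auto elim: eval_ScE)
    with xs obtain a as' where a: "as = a # as'" "y = Suc (s a)" by auto
    have "run (copy a d b) s (s(d := s a))" using as d z a by (intro run_copy) auto
    then show "run (comp_recf Sc as d b) s (s(d := y))"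
      using a by (auto intro!: run_Seq run_Inc')
  qed
next
  case (Proj i)
  show ?case unfolding correct_def
  proof (intro allI impI)
    fix xs y as d b and s :: "nat \<Rightarrow> nat"
    assume ev: "eval (Proj i) xs y" and xs: "map s as = xs"
      and as: "\<forall>a\<in>set as. a < b \<and> a \<noteq> d" and d: "d < b" "s d = 0" and z: "\<forall>j\<ge>b. s j = 0"
    from ev xs have "i < length as" "y = s (as ! i)" by (auto elim: eval_ProjE)
    moreover then have "as ! i < b" "as ! i \<noteq> d" using as nth_mem by blast+
    ultimately show "run (comp_recf (Proj i) as d b) s (s(d := y))"
      using d z by (auto intro!: run_copy)
  qed
qed (auto intro: correct_Cn correct_Pr correct_Mn)

section \<open>Counter machines\<close>

text \<open>\<open>INC i p\<close> increments register \<open>i\<close> and jumps to \<open>p\<close>; \<open>DEC i p z\<close> jumps to \<open>z\<close> if register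
  \<open>i\<close> is zero, and otherwise decrements it and jumps to \<open>p\<close>. Labels are positions in the list;
  labels outside the list are rejecting.\<close>

datatype instr = INC nat nat | DEC nat nat nat | ACC

text \<open>The code of the program is entered at label \<open>n\<close> and left by a jump to
  \<open>m\<close>. Clearing is a decrement that jumps to itself; a loop body returns to the test at
  \<open>n\<close>.\<close>

fun impl :: "instr list \<Rightarrow> prog \<Rightarrow> nat \<Rightarrow> nat \<Rightarrow> bool" where
  "impl M (Inc i) n m \<longleftrightarrow> n < length M \<and> M ! n = INC i m"
| "impl M (Clear i) n m \<longleftrightarrow> n < length M \<and> M ! n = DEC i n m"
| "impl M (Seq p q) n m \<longleftrightarrow> (\<exists>k. impl M p n k \<and> impl M q k m)"
| "impl M (Loop i p) n m \<longleftrightarrow> (\<exists>k. n < length M \<and> M ! n = DEC i k m \<and> impl M p k n)"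

definition code_for :: "prog \<Rightarrow> nat \<Rightarrow> nat \<Rightarrow> instr list \<Rightarrow> bool" where
  "code_for p n m c \<longleftrightarrow> (\<forall>pre post. length pre = n \<longrightarrow> impl (pre @ c @ post) p n m)"

text \<open>The length \<open>l\<close> is fixed before the labels: in a sequence, the first part
  must jump to the start of the second, which lies \<open>l\<close> further on.\<close>

lemma code_for_exists: "\<exists>l. \<forall>n m. \<exists>c. length c = l \<and> code_for p n m c"
proof (induction p)
  case (Inc i)
  have "length [INC i m] = 1 \<and> code_for (Inc i) n m [INC i m]" for n m
    by (auto simp: code_for_def nth_append)
  then show ?case by meson
next
  case (Clear i)
  have "length [DEC i n m] = 1 \<and> code_for (Clear i) n m [DEC i n m]" for n m
    by (auto simp: code_for_def nth_append)
  then show ?case by meson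
next
  case (Seq p q)
  from Seq.IH obtain l l' where
    p: "\<forall>n m. \<exists>c. length c = l \<and> code_for p n m c" and
    q: "\<forall>n m. \<exists>c. length c = l' \<and> code_for q n m c" by (elim exE)
  have "\<exists>c. length c = l + l' \<and> code_for (Seq p q) n m c" for n m
  proof -
    obtain c where c: "length c = l" "code_for p n (n + l) c" using p by meson
    obtain c' where c': "length c' = l'" "code_for q (n + l) m c'" using q by meson
    have "impl (pre @ (c @ c') @ post) (Seq p q) n m" if n: "length pre = n" for pre post
    proof -
      have "impl (pre @ c @ c' @ post) p n (n + l)"
        using c(2) n by (simp add: code_for_def)
      moreover have "impl ((pre @ c) @ c' @ post) q (n + l) m"
        using c'(2) n c(1) unfolding code_for_def by (metis length_append)
      ultimately show ?thesis by auto
    qed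
    then have "code_for (Seq p q) n m (c @ c')" by (simp add: code_for_def)
    then show ?thesis using c(1) c'(1) by (intro exI[of _ "c @ c'"]) auto
  qed
  then show ?case by meson
next
  case (Loop i p)
  from Loop.IH obtain l where p: "\<forall>n m. \<exists>c. length c = l \<and> code_for p n m c" by (elim exE)
  have "\<exists>c. length c = Suc l \<and> code_for (Loop i p) n m c" for n m
  proof -
    obtain c where c: "length c = l" "code_for p (Suc n) n c" using p by meson
    have "impl (pre @ (DEC i (Suc n) m # c) @ post) (Loop i p) n m" if n: "length pre = n" for pre post
    proof -
      have "impl ((pre @ [DEC i (Suc n) m]) @ c @ post) p (Suc n) n"
        using c(2) n unfolding code_for_def by (metis length_append_singleton)
      then show ?thesis using n by (auto simp: nth_append)
    qed
    then have "code_for (Loop i p) n m (DEC i (Suc n) m # c)" by (simp add: code_for_def)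
    then show ?thesis using c(1) by (intro exI[of _ "DEC i (Suc n) m # c"]) auto
  qed
  then show ?case by meson
qed

fun bounded_instr :: "nat \<Rightarrow> instr \<Rightarrow> bool" where
  "bounded_instr B (INC i p) \<longleftrightarrow> i < B \<and> p < B"
| "bounded_instr B (DEC i p z) \<longleftrightarrow> i < B \<and> p < B \<and> z < B"
| "bounded_instr B ACC \<longleftrightarrow> True"

lemma bounded_instr_mono: "bounded_instr B c \<Longrightarrow> B \<le> B' \<Longrightarrow> bounded_instr B' c"
  by (cases c) auto

lemma bounded_instr_exists: "\<exists>B. \<forall>c\<in>set M. bounded_instr B c"
proof (induction M)
  case (Cons c M)
  then obtain B where B: "\<forall>c\<in>set M. bounded_instr B c" by blast
  obtain B' where B': "bounded_instr B' c"
  proof (cases c)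
    case (INC i p)
    then show thesis by (intro that[of "Suc (i + p)"]) auto
  next
    case (DEC i p z)
    then show thesis by (intro that[of "Suc (i + p + z)"]) auto
  qed (auto intro: that)
  show ?case using B B' by (intro exI[of _ "max B B'"]) (auto intro: bounded_instr_mono)
qed simp

section \<open>The class table of a counter machine\<close>

text \<open>In \<open>\<langle>A x \<le> D y\<rangle>\<close> the class \<open>A\<close> is the top symbol of the active stack, \<open>y\<close> is the passive stack,
  and the message \<open>D\<close> carries the control state: \<open>Q q\<close> runs the instruction at \<open>q\<close>, \<open>Ret p\<close> moves
  the active stack back onto the passive one and then jumps to \<open>p\<close>, and \<open>Mv j D\<close> pushes \<open>j\<close> onto
  the active stack and proceeds with \<open>D\<close>. Every step exchanges the two stacks.
  Symbol \<open>0\<close> is the stack bottom and \<open>Suc i\<close> is one unit of register \<open>i\<close>; class \<open>0\<close> is nullary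
  and all others are unary.\<close>

datatype msg = Q nat | Ret nat | Mv nat msg

fun msg_code :: "msg \<Rightarrow> nat" where
  "msg_code (Q q) = prod_encode (0, q)"
| "msg_code (Ret p) = prod_encode (1, p)"
| "msg_code (Mv j D) = prod_encode (Suc (Suc j), msg_code D)"

lemma msg_code_inject [simp]: "msg_code D = msg_code E \<longleftrightarrow> D = E"
proof (induction D arbitrary: E)
  case (Q q)
  then show ?case by (cases E) auto
next
  case (Ret p)
  then show ?case by (cases E) auto
next
  case (Mv j D)
  then show ?case by (cases E) auto
qed

text \<open>The tags 0 and 1 separate symbols from messages, and \<open>Suc\<close> keeps class 0
  free for \<open>Unit\<close>.\<close>

definition scls :: "nat \<Rightarrow> nat" where
  "scls a = Suc (prod_encode (0, a))"

definition mcls :: "msg \<Rightarrow> nat" where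
  "mcls D = Suc (prod_encode (1, msg_code D))"

lemma cls_simps [simp]:
  "scls a = scls b \<longleftrightarrow> a = b" "mcls D = mcls E \<longleftrightarrow> D = E" "scls a \<noteq> mcls D" "mcls D \<noteq> scls a"
  "scls a \<noteq> 0" "mcls D \<noteq> 0" "0 < scls a" "0 < mcls D"
  by (auto simp: scls_def mcls_def)

abbreviation "Unit \<equiv> TApp 0 []"
abbreviation "Sym a t \<equiv> TApp (scls a) [t]"
abbreviation "Msg D t \<equiv> TApp (mcls D) [t]"
abbreviation "X \<equiv> TVar 0"

text \<open>The body of the rule \<open>Sym a X\<close> \<lhd> \<open>Msg D body\<close>. By
  contravariance the query \<open>Sym a s\<close> \<le> \<open>Msg D t\<close> turns into
  \<open>t\<close> \<le> \<open>body\<close> with \<open>s\<close> for \<open>X\<close>. On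
  \<open>ACC\<close> the body is the empty stack, so with an empty passive stack the next query
  holds by reflexivity.\<close>

fun delta :: "instr list \<Rightarrow> nat \<Rightarrow> msg \<Rightarrow> ty option" where
  "delta M a (Q q) = (if q < length M then Some (case M ! q of
       INC i p \<Rightarrow> Msg (Ret p) (Sym (Suc i) (Sym a X))
     | DEC i p z \<Rightarrow>
         if a = 0 then Msg (Ret z) (Sym 0 X)
         else if a = Suc i then Msg (Ret p) X
         else Msg (Mv a (Q q)) X
     | ACC \<Rightarrow> Sym 0 Unit) else None)"
| "delta M a (Ret p) = Some (if a = 0 then Msg (Q p) (Sym 0 X) else Msg (Mv a (Ret p)) X)"
| "delta M a (Mv j D) = Some (Msg D (Sym j (Sym a X)))"

definition base_msgs :: "nat \<Rightarrow> msg list" where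
  "base_msgs B = map Q [0..<B] @ map Ret [0..<B]"

text \<open>A push only ever wraps a \<open>Q\<close> or \<open>Ret\<close>, so finitely many
  messages suffice. Symbols run up to \<open>B\<close> because register \<open>i < B\<close> is
  symbol \<open>Suc i\<close>.\<close>

definition msgs :: "nat \<Rightarrow> msg list" where
  "msgs B = base_msgs B @ concat (map (\<lambda>j. map (Mv j) (base_msgs B)) [0..<Suc B])"

lemma set_msgs:
  "Q q \<in> set (base_msgs B) \<longleftrightarrow> q < B" "Ret p \<in> set (base_msgs B) \<longleftrightarrow> p < B"
  "Q q \<in> set (msgs B) \<longleftrightarrow> q < B" "Ret p \<in> set (msgs B) \<longleftrightarrow> p < B"
  "Mv j D \<in> set (msgs B) \<longleftrightarrow> j \<le> B \<and> D \<in> set (base_msgs B)"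
proof -
  show *: "Q q \<in> set (base_msgs B) \<longleftrightarrow> q < B" "Ret p \<in> set (base_msgs B) \<longleftrightarrow> p < B"
    by (auto simp: base_msgs_def)
  have **: "set (msgs B) = set (base_msgs B) \<union> (\<Union>j\<in>{..B}. Mv j ` set (base_msgs B))"
    by (simp add: msgs_def atLeast0LessThan lessThan_Suc_atMost del: upt_Suc)
  have "Mv j D \<notin> set (base_msgs B)" by (auto simp: base_msgs_def)
  with * show "Q q \<in> set (msgs B) \<longleftrightarrow> q < B" "Ret p \<in> set (msgs B) \<longleftrightarrow> p < B"
    "Mv j D \<in> set (msgs B) \<longleftrightarrow> j \<le> B \<and> D \<in> set (base_msgs B)"
    unfolding ** by auto
qed

definition rules_of :: "instr list \<Rightarrow> nat \<Rightarrow> msg \<Rightarrow> rule list" where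
  "rules_of M a D = (case delta M a D of None \<Rightarrow> [] | Some t \<Rightarrow> [(scls a, [0], mcls D, [t])])"

definition table :: "instr list \<Rightarrow> nat \<Rightarrow> class_table" where
  "table M B = concat (map (\<lambda>a. concat (map (rules_of M a) (msgs B))) [0..<Suc B])"

lemma set_table: "set (table M B) =
    {(scls a, [0], mcls D, [t]) | a D t. a \<le> B \<and> D \<in> set (msgs B) \<and> delta M a D = Some t}"
  by (fastforce simp: table_def rules_of_def less_Suc_eq_le split: option.splits)

lemma inh_table: "inh (table M B) s t \<longleftrightarrow>
    (\<exists>a D u body. s = Sym a u \<and> t = Msg D (subst (\<lambda>_. u) body) \<and>
       a \<le> B \<and> D \<in> set (msgs B) \<and> delta M a D = Some body)" (is "?l \<longleftrightarrow> ?r")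
proof
  \<comment> \<open>Every body has at most the variable 0, so only \<open>\<sigma> 0\<close>
    matters.\<close>
  have *: "subst \<sigma> body = subst (\<lambda>_. \<sigma> 0) body" if "delta M a D = Some body" for \<sigma> a D body
    using that by (cases D) (auto split: if_splits instr.splits)
  assume ?l
  then obtain a D body \<sigma> where "a \<le> B" "D \<in> set (msgs B)" "delta M a D = Some body"
    "s = Sym a (\<sigma> 0)" "t = Msg D (subst \<sigma> body)"
    unfolding inh_def set_table by auto
  then show ?r using * by metis
next
  assume ?r
  then show ?l unfolding inh_def set_table by force
qed

text \<open>A rule leads from a symbol to a message, and no rule starts at a message, so inheritance
  chains have length at most one.\<close>

lemma inh_star_table: "inh_star (table M B) s t \<longleftrightarrow> s = t \<or> inh (table M B) s t"
proof
  assume "inh_star (table M B) s t"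
  then show "s = t \<or> inh (table M B) s t"
    by (induction rule: rtranclp_induct) (auto simp: inh_table)
qed auto

text \<open>\<open>delta\<close> is a function of symbol and message, and no message class is a
  symbol class, so the arguments at a given class are unique.\<close>

lemma no_mii_table: "no_mii ar (table M B)"
  unfolding no_mii_def inh_star_table inh_table by auto

text \<open>The top classes differ, so exactly one inheritance step must be taken, and its rule is
  determined. Hence unfolding a query is an equivalence.\<close>

lemma subtype_table_iff:
  assumes "a \<le> B" "D \<in> set (msgs B)"
  shows "subtype (table M B) (Sym a s) (Msg D t) \<longleftrightarrow>
    (\<exists>body. delta M a D = Some body \<and> subtype (table M B) t (subst (\<lambda>_. s) body))"
    (is "?l \<longleftrightarrow> ?r")
proof
  assume ?l
  then show ?r
    by (cases rule: subtype.cases) (auto simp: inh_star_table inh_table)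
next
  assume ?r
  then obtain body where b: "delta M a D = Some body"
    "subtype (table M B) t (subst (\<lambda>_. s) body)" by blast
  have "inh_star (table M B) (Sym a s) (Msg D (subst (\<lambda>_. s) body))"
    unfolding inh_star_table inh_table using assms b(1) by blast
  then show ?l using b(2) by (intro subtype.sub) auto
qed

text \<open>A type variable is not even a subtype of itself, hence the restriction to closed
  types.\<close>

lemma subtype_refl: "tvars t = {} \<Longrightarrow> subtype ct t t"
  by (induction t) (auto intro!: subtype.sub)

fun stk :: "nat list \<Rightarrow> ty" where
  "stk [] = Sym 0 Unit"
| "stk (i # w) = Sym (Suc i) (stk w)"

section \<open>Simulation of a counter machine by subtyping queries\<close>

locale machine =
  fixes M :: "instr list" and B :: nat
  assumes len: "length M \<le> B" and bounded: "\<And>c. c \<in> set M \<Longrightarrow> bounded_instr B c"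
begin

lemma bounded_nth: "q < length M \<Longrightarrow> bounded_instr B (M ! q)"
  by (simp add: bounded)

text \<open>\<open>w\<close> is the active and \<open>v\<close> the passive stack. A machine state
  has empty \<open>v\<close>, and the value of register \<open>i\<close> is the number of
  occurrences of \<open>i\<close> in \<open>w\<close>.\<close>

definition conf :: "msg \<Rightarrow> nat list \<Rightarrow> nat list \<Rightarrow> bool" where
  "conf D w v \<longleftrightarrow> subtype (table M B) (stk w) (Msg D (stk v))"

lemma conf_Mv:
  assumes "set v \<subseteq> {..<B}" "Mv (Suc j) D \<in> set (msgs B)"
  shows "conf (Mv (Suc j) D) v w \<longleftrightarrow> conf D w (j # v)"
proof (cases v)
  case Nil
  then show ?thesis using assms by (simp add: conf_def subtype_table_iff)
next
  case (Cons i v')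
  then show ?thesis using assms by (simp add: conf_def subtype_table_iff)
qed

text \<open>Each entry of \<open>v\<close> is moved onto \<open>w\<close> by two steps, which
  reverses their order; at the bottom of \<open>v\<close> the stacks change roles.\<close>

lemma conf_Ret:
  assumes "set v \<subseteq> {..<B}" "set w \<subseteq> {..<B}" "p < B"
  shows "conf (Ret p) v w \<longleftrightarrow> conf (Q p) (rev v @ w) []"
  using assms
proof (induction v arbitrary: w)
  case Nil
  then show ?case by (simp add: conf_def subtype_table_iff set_msgs)
next
  case (Cons j v)
  have "conf (Ret p) (j # v) w \<longleftrightarrow> conf (Mv (Suc j) (Ret p)) w v"
    using Cons.prems by (simp add: conf_def subtype_table_iff set_msgs)
  also have "\<dots> \<longleftrightarrow> conf (Ret p) v (j # w)"
    using Cons.prems by (intro conf_Mv) (auto simp: set_msgs)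
  finally show ?case using Cons by simp
qed

lemma conf_INC:
  assumes "q < length M" "M ! q = INC i p" "set w \<subseteq> {..<B}"
  shows "conf (Q q) w [] \<longleftrightarrow> conf (Q p) (i # w) []"
proof -
  have B: "i < B" "p < B" "q < B"
    using bounded_nth[of q] len assms by auto
  have "conf (Q q) w [] \<longleftrightarrow> conf (Ret p) [] (i # w)"
    using assms B by (cases w) (simp_all add: conf_def subtype_table_iff set_msgs)
  then show ?thesis using assms B by (simp add: conf_Ret)
qed

text \<open>The search for \<open>i\<close> moves the entries it passes onto the passive stack, so
  the induction needs arbitrary \<open>v\<close>.\<close>

lemma conf_DEC:
  assumes "q < length M" "M ! q = DEC i p z" "set w \<subseteq> {..<B}" "set v \<subseteq> {..<B}"
  shows "conf (Q q) w v \<longleftrightarrow> (if i \<in> set w then conf (Q p) (rev v @ remove1 i w) []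
                                 else conf (Q z) (rev v @ w) [])"
  using assms
proof (induction w arbitrary: v)
  case Nil
  have B: "z < B" "q < B"
    using bounded_nth[of q] len assms by auto
  have "conf (Q q) [] v \<longleftrightarrow> conf (Ret z) v []"
    using Nil B by (simp add: conf_def subtype_table_iff set_msgs)
  then show ?case using Nil B by (simp add: conf_Ret)
next
  case (Cons j w)
  have B: "p < B" "q < B"
    using bounded_nth[of q] len assms by auto
  show ?case
  proof (cases "j = i")
    case True
    have "conf (Q q) (j # w) v \<longleftrightarrow> conf (Ret p) v w"
      using Cons.prems B True by (simp add: conf_def subtype_table_iff set_msgs)
    then show ?thesis using Cons.prems B True by (simp add: conf_Ret)
  next
    case False
    have "conf (Q q) (j # w) v \<longleftrightarrow> conf (Mv (Suc j) (Q q)) v w"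
      using Cons.prems B False by (simp add: conf_def subtype_table_iff set_msgs)
    also have "\<dots> \<longleftrightarrow> conf (Q q) w (j # v)"
      using Cons.prems B by (intro conf_Mv) (auto simp: set_msgs)
    finally show ?thesis using Cons False by simp
  qed
qed

lemma conf_ACC:
  assumes "q < length M" "M ! q = ACC" "set w \<subseteq> {..<B}"
  shows "conf (Q q) w []"
  using assms len
  by (cases w) (auto simp: conf_def subtype_table_iff set_msgs intro!: subtype_refl)

lemma conf_reject:
  assumes "length M \<le> q" "q < B" "set w \<subseteq> {..<B}"
  shows "\<not> conf (Q q) w []"
  using assms by (cases w) (auto simp: conf_def subtype_table_iff set_msgs)

text \<open>Only this direction of the simulation is needed, because every step of the machine is an
  equivalence of subtyping judgements.\<close>

lemma conf_run:
  assumes "run p s s'" "impl M p n m" "count_list w = s" "set w \<subseteq> {..<B}"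
  shows "\<exists>w'. count_list w' = s' \<and> set w' \<subseteq> {..<B} \<and> (conf (Q n) w [] \<longleftrightarrow> conf (Q m) w' [])"
  using assms
proof (induction p s s' arbitrary: n m w rule: run.induct)
  case (run_Inc i s)
  then have "i < B" using bounded_nth[of n] by auto
  then show ?case using run_Inc by (intro exI[of _ "i # w"]) (auto simp: conf_INC fun_eq_iff)
next
  case (run_Clear i s)
  \<comment> \<open>The instruction jumps back to its own label \<open>n\<close>, hence an induction
    on the number of units of register \<open>i\<close>.\<close>
  have "\<exists>w'. count_list w' = (count_list w)(i := 0) \<and> set w' \<subseteq> {..<B} \<and>
     (conf (Q n) w [] \<longleftrightarrow> conf (Q m) w' [])"
    using run_Clear(3)
  proof (induction "count_list w i" arbitrary: w)
    case 0
    then have "i \<notin> set w" by (metis count_list_0_iff)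
    then show ?case using 0 run_Clear(1) by (intro exI[of _ w]) (auto simp: conf_DEC fun_eq_iff)
  next
    case (Suc k)
    then have i: "i \<in> set w" by (metis count_list_0_iff nat.simps(3))
    have cnt: "count_list (remove1 i w) = (count_list w)(i := k)"
      using Suc(2) by (auto simp: fun_eq_iff count_list_remove1 i)
    have sub: "set (remove1 i w) \<subseteq> {..<B}"
      using Suc(3) set_remove1_subset by fastforce
    from Suc(1)[of "remove1 i w"] cnt sub obtain w' where
      "count_list w' = (count_list w)(i := 0)" "set w' \<subseteq> {..<B}"
      "conf (Q n) (remove1 i w) [] \<longleftrightarrow> conf (Q m) w' []" by auto
    then show ?case
      using i Suc(3) run_Clear(1) by (intro exI[of _ w']) (auto simp: conf_DEC)
  qed
  then show ?case unfolding run_Clear(2) .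
next
  case (run_Seq p s s' q s'')
  from run_Seq.prems(1) obtain k where k: "impl M p n k" "impl M q k m" by auto
  from run_Seq.IH(1)[OF k(1) run_Seq.prems(2,3)] obtain w1 where w1:
    "count_list w1 = s'" "set w1 \<subseteq> {..<B}" "conf (Q n) w [] \<longleftrightarrow> conf (Q k) w1 []" by (elim exE conjE)
  from run_Seq.IH(2)[OF k(2) w1(1,2)] w1(3) show ?case by simp
next
  case (run_Loop0 s i p)
  then have "i \<notin> set w" by (metis count_list_0_iff)
  then show ?case using run_Loop0 by (intro exI[of _ w]) (auto simp: conf_DEC)
next
  case (run_LoopS s i k p s' s'')
  then have i: "i \<in> set w" by (metis count_list_0_iff nat.simps(3))
  have cnt: "count_list (remove1 i w) = s(i := k)"
    using run_LoopS.hyps(1) run_LoopS.prems(2) by (auto simp: fun_eq_iff count_list_remove1 i)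
  have sub: "set (remove1 i w) \<subseteq> {..<B}"
    using run_LoopS.prems set_remove1_subset by fastforce
  from run_LoopS.prems obtain h where
    h: "n < length M" "M ! n = DEC i h m" "impl M p h n" by auto
  from run_LoopS.IH(1)[OF h(3) cnt sub] obtain w1 where w1:
    "count_list w1 = s'" "set w1 \<subseteq> {..<B}" "conf (Q h) (remove1 i w) [] \<longleftrightarrow> conf (Q n) w1 []"
    by (elim exE conjE)
  from run_LoopS.IH(2)[OF run_LoopS.prems(1) w1(1,2)] obtain w2 where
    "count_list w2 = s''" "set w2 \<subseteq> {..<B}" "conf (Q n) w1 [] \<longleftrightarrow> conf (Q m) w2 []"
    by (elim exE conjE)
  then show ?case
    using h w1 i run_LoopS.prems by (intro exI[of _ w2]) (auto simp: conf_DEC)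
qed

end

section \<open>Arities\<close>

fun unary :: "ty \<Rightarrow> bool" where
  "unary (TVar x) \<longleftrightarrow> True"
| "unary (TApp c ts) \<longleftrightarrow> length ts = (if c = 0 then 0 else 1) \<and> (\<forall>t\<in>set ts. unary t)"

fun classes :: "ty \<Rightarrow> nat set" where
  "classes (TVar x) = {}"
| "classes (TApp c ts) = insert c (\<Union>t\<in>set ts. classes t)"

lemma finite_classes: "finite (classes t)"
  by (induction t) auto

text \<open>The leading pair shadows the entry \<open>(0, 1)\<close>, since \<open>map_of\<close>
  takes the first match.\<close>

definition arity_table :: "nat \<Rightarrow> arity_map" where
  "arity_table N = (0, 0) # map (\<lambda>c. (c, 1)) [0..<N]"

lemma map_of_arity_table: "c < N \<Longrightarrow> map_of (arity_table N) c = Some (if c = 0 then 0 else 1)"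
  by (auto simp: arity_table_def map_of_map_restrict restrict_map_def)

lemma wf_ty_arity_table: "unary t \<Longrightarrow> classes t \<subseteq> {..<N} \<Longrightarrow> wf_ty (arity_table N) t"
  by (induction t) (auto simp: map_of_arity_table UN_subset_iff)

lemma unary_stk: "unary (stk w)"
  by (induction w) auto

lemma classes_stk: "set w \<subseteq> {..<B} \<Longrightarrow> classes (stk w) \<subseteq> insert 0 (scls ` {..B})"
  by (induction w) auto

lemma tvars_stk: "tvars (stk w) = {}"
  by (induction w) auto

lemma delta_shape:
  assumes "delta M a D = Some t"
  shows "unary t" "tvars t \<subseteq> {0}"
  using assms by (cases D; auto split: if_splits instr.splits)+

text \<open>Only finitely many classes occur in the rules; those needed for the initial query are
  added before a bound is taken.\<close>

lemma arity_table_exists: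
  "\<exists>N. wf_table (arity_table N) (table M B) \<and> insert 0 (insert (mcls (Q 0)) (scls ` {..B})) \<subseteq> {..<N}"
proof -
  let ?cls = "\<lambda>(C, xs, D, ts). insert C (insert D (\<Union>t\<in>set ts. classes t))"
  let ?S = "(\<Union>r\<in>set (table M B). ?cls r) \<union> insert 0 (insert (mcls (Q 0)) (scls ` {..B}))"
  have "finite ?S" by (auto simp: finite_classes)
  then obtain N where N: "?S \<subseteq> {..<N}" by (metis finite_nat_set_iff_bounded lessThan_iff subsetI)
  have "wf_rule (arity_table N) r" if r: "r \<in> set (table M B)" for r
  proof -
    from r obtain a D t where t: "r = (scls a, [0], mcls D, [t])" "delta M a D = Some t"
      unfolding set_table by blast
    have "?cls r \<subseteq> {..<N}" using N r by blast
    then show ?thesis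
      using delta_shape[OF t(2)] by (auto simp: t(1) map_of_arity_table wf_ty_arity_table)
  qed
  then show ?thesis using N unfolding wf_table_def by blast
qed

section \<open>Diagonalization\<close>

lemma machine_exists:
  "\<exists>M B. machine M B \<and> 2 \<le> B \<and>
     (\<forall>a b y. eval f [a, b] y \<longrightarrow>
        (machine.conf M B (Q 0) (replicate a 0 @ replicate b 1) [] \<longleftrightarrow> y = 0))"
proof -
  let ?p = "comp_recf f [0, 1] 2 3"
  obtain l where l: "\<forall>n m. \<exists>c. length c = l \<and> code_for ?p n m c"
    using code_for_exists[of ?p] by (elim exE)
  obtain c where c: "length c = l" "code_for ?p 0 l c" using l by meson
  \<comment> \<open>The output in register 2 is tested: zero leads to \<open>ACC\<close> at
    \<open>l + 1\<close>, nonzero to \<open>l + 2\<close>, just outside the code, which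
    rejects.\<close>
  define M where "M = c @ [DEC 2 (l + 2) (l + 1), ACC]"
  have M: "impl M ?p 0 l" "M ! l = DEC 2 (l + 2) (l + 1)" "M ! (l + 1) = ACC" "length M = l + 2"
    using c(2)[unfolded code_for_def, rule_format, of "[]"] c(1) by (auto simp: M_def nth_append)
  obtain B0 where B0: "\<forall>c\<in>set M. bounded_instr B0 c" using bounded_instr_exists by blast
  \<comment> \<open>The bound also covers the rejecting label \<open>l + 2\<close>.\<close>
  define B where "B = max B0 (l + 3)"
  interpret machine M B
    by unfold_locales (use B0 M(4) in \<open>auto simp: B_def intro: bounded_instr_mono\<close>)
  have "conf (Q 0) (replicate a 0 @ replicate b 1) [] \<longleftrightarrow> y = 0" (is "conf _ ?w _ \<longleftrightarrow> _")
    if ev: "eval f [a, b] y" for a b y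
  proof -
    let ?s = "count_list ?w"
    have cnt: "count_list (replicate n x) z = (if x = z then n else 0)" for n and x z :: nat
      by (induction n) auto
    have s: "?s = (\<lambda>_. 0)(0 := a, 1 := b)" by (rule ext) (simp add: cnt)
    have "run ?p ?s (?s(2 := y))"
      by (rule correctD[OF comp_recf_correct ev]) (auto simp: cnt)
    from conf_run[OF this M(1) refl] obtain w where
      w: "count_list w = ?s(2 := y)" "set w \<subseteq> {..<B}" "conf (Q 0) ?w [] \<longleftrightarrow> conf (Q l) w []"
      by (force simp: B_def)
    have "y = 0 \<longleftrightarrow> 2 \<notin> set w" using w(1) by (metis count_list_0_iff fun_upd_same)
    moreover have "conf (Q l) w [] \<longleftrightarrow>
        (if 2 \<in> set w then conf (Q (l + 2)) (remove1 2 w) [] else conf (Q (l + 1)) w [])"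
      using conf_DEC[of l 2 "l + 2" "l + 1" w "[]"] M w(2) by simp
    moreover have "\<not> conf (Q (l + 2)) (remove1 2 w) []"
      using M w(2) set_remove1_subset by (intro conf_reject) (fastforce simp: B_def)+
    moreover have "conf (Q (l + 1)) w []"
      using M w(2) by (intro conf_ACC) auto
    ultimately show ?thesis using w(3) by auto
  qed
  moreover have "2 \<le> B" by (simp add: B_def)
  ultimately show ?thesis using machine_axioms by blast
qed

text \<open>Follows \<open>enc_ty\<close>, where \<open>list_encode [x]\<close> is
  \<open>Suc (prod_encode (x, 0))\<close>.\<close>

definition rf_enc_unary :: "nat \<Rightarrow> recf \<Rightarrow> recf" where
  "rf_enc_unary c g =
     rf_pair (rf_const 1) (rf_pair (rf_const c) (Cn Sc [rf_pair g (rf_const 0)]))"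

lemma eval_enc_unary:
  "eval g xs (enc_ty t) \<Longrightarrow> eval (rf_enc_unary c g) xs (enc_ty (TApp c [t]))"
  by (auto simp: rf_enc_unary_def simp del: rf_const.simps intro!: eval_pair eval_const eval_Cn1 ev_S)

text \<open>The outer recursion adds the \<open>a\<close> units of register 0 (symbol 1) to a stack
  on which the inner one has put the \<open>b\<close> units of register 1 (symbol 2).\<close>

definition rf_enc_stk :: recf where
  "rf_enc_stk = Pr (Pr (rf_const (enc_ty (stk []))) (rf_enc_unary (scls 2) (Proj 1)))
                   (rf_enc_unary (scls 1) (Proj 1))"

lemma eval_enc_stk: "eval rf_enc_stk [a, b] (enc_ty (stk (replicate a 0 @ replicate b 1)))"
proof -
  have b: "eval (Pr (rf_const (enc_ty (stk []))) (rf_enc_unary (scls 2) (Proj 1))) [b]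
       (enc_ty (stk (replicate b 1)))"
  proof (induction b)
    case 0
    show ?case unfolding replicate.simps by (intro ev_Pr0 eval_const)
  next
    case (Suc b)
    have "eval (rf_enc_unary (scls 2) (Proj 1)) [b, enc_ty (stk (replicate b 1))]
        (enc_ty (Sym 2 (stk (replicate b 1))))"
      by (intro eval_enc_unary eval_Proj) auto
    with Suc show ?case by (auto intro: ev_PrS simp: numeral_2_eq_2 simp del: enc_ty.simps)
  qed
  show ?thesis unfolding rf_enc_stk_def
  proof (induction a)
    case 0
    show ?case using b by (auto intro: ev_Pr0)
  next
    case (Suc a)
    let ?t = "stk (replicate a 0 @ replicate b 1)"
    have "eval (rf_enc_unary (scls 1) (Proj 1)) [a, enc_ty ?t, b] (enc_ty (Sym 1 ?t))"
      by (intro eval_enc_unary eval_Proj) auto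
    with Suc show ?case by (auto intro: ev_PrS simp del: enc_ty.simps)
  qed
qed

theorem theorem1:
  shows "\<not> (\<exists>r. \<forall>ar ct t t'. valid_instance ar ct t t' \<longrightarrow>
            eval r [enc_instance ar ct t t'] (if subtype ct t t' then 1 else 0))"
proof
  assume "\<exists>r. \<forall>ar ct t t'. valid_instance ar ct t t' \<longrightarrow>
            eval r [enc_instance ar ct t t'] (if subtype ct t t' then 1 else 0)"
  then obtain r where r: "\<And>ar ct t t'. valid_instance ar ct t t' \<Longrightarrow>
      eval r [enc_instance ar ct t t'] (if subtype ct t t' then 1 else 0)" by blast
  define goal where "goal = Msg (Q 0) (stk [])"
  \<comment> \<open>The inputs are used twice: as codes of arity map and table, and as register
    contents on the initial stack.\<close>
  define f where "f = Cn r [rf_pair (Proj 0) (rf_pair (Proj 1)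
      (rf_pair rf_enc_stk (rf_const (enc_ty goal))))]"
  obtain M B where MB: "machine M B" "2 \<le> B" and
    f: "\<And>a b y. eval f [a, b] y \<Longrightarrow>
       machine.conf M B (Q 0) (replicate a 0 @ replicate b 1) [] \<longleftrightarrow> y = 0"
    using machine_exists[of f] by blast
  obtain N where N: "wf_table (arity_table N) (table M B)"
    "insert 0 (insert (mcls (Q 0)) (scls ` {..B})) \<subseteq> {..<N}" using arity_table_exists by blast
  \<comment> \<open>The diagonal choice: the machine for \<open>f\<close> is given the codes of its
    own arity map and table.\<close>
  define a where "a = list_encode (map prod_encode (arity_table N))"
  define b where "b = list_encode (map enc_rule (table M B))"
  define w :: "nat list" where "w = replicate a 0 @ replicate b 1"
  have w: "set w \<subseteq> {..<B}" using MB(2) by (auto simp: w_def)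
  have "classes (stk w) \<subseteq> {..<N}" "classes goal \<subseteq> {..<N}"
    using N(2) classes_stk[OF w] by (auto simp: goal_def)
  moreover have "unary goal" "tvars goal = {}" by (auto simp: goal_def)
  ultimately have "valid_instance (arity_table N) (table M B) (stk w) goal"
    unfolding valid_instance_def ground_def
    using N(1) by (simp add: no_mii_table unary_stk tvars_stk wf_ty_arity_table)
  note ev = r[OF this]
  have "eval (rf_pair (Proj 0) (rf_pair (Proj 1) (rf_pair rf_enc_stk (rf_const (enc_ty goal)))))
      [a, b] (enc_instance (arity_table N) (table M B) (stk w) goal)"
    unfolding enc_instance_def a_def[symmetric] b_def[symmetric] w_def
    by (intro eval_pair eval_enc_stk eval_const eval_Proj) auto
  then have "eval f [a, b] (if subtype (table M B) (stk w) goal then 1 else 0)"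
    unfolding f_def by (rule eval_Cn1[OF _ ev])
  \<comment> \<open>The query holds iff the machine accepts, thus iff the answer of \<open>r\<close>
    is 0, thus iff the query fails.\<close>
  from f[OF this] show False
    unfolding machine.conf_def[OF MB(1)] w_def goal_def by (auto split: if_splits)
qed

end
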